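(* There does not exist a $(v,4,k,\lambda)$-SEDF for any $v>4$.
   Context: Let $v,m,k,\lambda$ be positive integers with $k^2(m-1)=\lambda(v-1)$. A $(v,m,k,\lambda)$-SEDF (strong external difference family) is a collection $(D_1,\ldots,D_m)$ of pairwise disjoint subsets of some finite abelian group $G$ (written multiplicatively, with identity $1$) with $|G|=v$ and $|D_j|=k$ for all $1\le j\le m$, such that for each $1\le j\le m$ the equation $\sum_{\ell\ne j} D_j D_\ell^{-1}=\lambda(G-1)$ holds in the group algebra $\mathbb{C}[G]$. Here a subset $S\subseteq G$ is identified with the group algebra element $\sum_{g\in S} g$, and $S^{-1}$ denotes $\sum_{g\in S} g^{-1}$. *)

theory Defs
  imports Complex_Main "HOL-Library.Disjoint_Sets" "HOL-Algebra.Coset" "HOL-Algebra.Module"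
begin

text \<open>
  The group algebra of a finite group \<open>G\<close> over the complex numbers. An element
  \<open>\<Sum>g\<in>G. f g * g\<close> is represented by its coefficient function \<open>f\<close>, which is taken to be
  zero outside \<open>carrier G\<close> so that equality of algebra elements is equality of functions.
  Multiplication is convolution: the coefficient of \<open>x\<close> in \<open>f * h\<close> collects
  the products \<open>f y * h z\<close> with \<open>y \<otimes> z = x\<close>.
\<close>

definition group_algebra :: "('a, 'b) monoid_scheme \<Rightarrow> (complex, 'a \<Rightarrow> complex) module" where
  "group_algebra G =
    \<lparr>carrier = {f. \<forall>x. x \<notin> carrier G \<longrightarrow> f x = 0},
     mult = (\<lambda>f h x. if x \<in> carrier G
                     then (\<Sum>y\<in>carrier G. f y * h (inv\<^bsub>G\<^esub> y \<otimes>\<^bsub>G\<^esub> x)) else 0),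
     one = (\<lambda>x. if x = \<one>\<^bsub>G\<^esub> then 1 else 0),
     zero = (\<lambda>x. 0),
     add = (\<lambda>f h x. f x + h x),
     smult = (\<lambda>c f x. c * f x)\<rparr>"

definition group_elem :: "'a \<Rightarrow> 'a \<Rightarrow> complex" where
  "group_elem g = (\<lambda>x. if x = g then 1 else 0)"

definition set_elem :: "('a, 'b) monoid_scheme \<Rightarrow> 'a set \<Rightarrow> 'a \<Rightarrow> complex" where
  "set_elem G S = (\<Oplus>\<^bsub>group_algebra G\<^esub> g\<in>S. group_elem g)"

text \<open>The element \<open>S\<^sup>-\<^sup>1\<close> of the group algebra; it is not a multiplicative inverse.\<close>

definition set_inv_elem :: "('a, 'b) monoid_scheme \<Rightarrow> 'a set \<Rightarrow> 'a \<Rightarrow> complex" where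
  "set_inv_elem G S = (\<Oplus>\<^bsub>group_algebra G\<^esub> g\<in>S. group_elem (inv\<^bsub>G\<^esub> g))"

definition SEDF ::
  "('a, 'b) monoid_scheme \<Rightarrow> (nat \<Rightarrow> 'a set) \<Rightarrow> nat \<Rightarrow> nat \<Rightarrow> nat \<Rightarrow> nat \<Rightarrow> bool" where
  "SEDF G D v m k l \<longleftrightarrow>
     v > 0 \<and> m > 0 \<and> k > 0 \<and> l > 0 \<and> k\<^sup>2 * (m - 1) = l * (v - 1) \<and>
     comm_group G \<and> finite (carrier G) \<and> order G = v \<and>
     (\<forall>j\<in>{1..m}. D j \<subseteq> carrier G \<and> card (D j) = k) \<and>
     disjoint_family_on D {1..m} \<and>
     (\<forall>j\<in>{1..m}.
        (\<Oplus>\<^bsub>group_algebra G\<^esub> i\<in>{1..m} - {j}.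
            set_elem G (D j) \<otimes>\<^bsub>group_algebra G\<^esub> set_inv_elem G (D i))
        = of_nat l \<odot>\<^bsub>group_algebra G\<^esub>
            (set_elem G (carrier G) \<ominus>\<^bsub>group_algebra G\<^esub> \<one>\<^bsub>group_algebra G\<^esub>))"

text \<open>
  The record above is indeed a commutative algebra over the complex numbers, so the library's
  finite sums and differences have their usual meaning in it.
\<close>

definition complex_ring :: "complex ring" where
  "complex_ring = \<lparr>carrier = UNIV, mult = (*), one = 1, zero = 0, add = (+)\<rparr>"

lemma cring_complex_ring: "cring complex_ring"
proof (intro cringI abelian_groupI comm_monoidI)
  fix x :: complex
  show "\<exists>y\<in>carrier complex_ring. y \<oplus>\<^bsub>complex_ring\<^esub> x = \<zero>\<^bsub>complex_ring\<^esub>"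
    by (rule bexI[of _ "- x"]) (auto simp: complex_ring_def)
qed (auto simp: complex_ring_def algebra_simps)

lemma group_algebra_abelian_group: "abelian_group (group_algebra G)"
proof (rule abelian_groupI)
  fix f assume "f \<in> carrier (group_algebra G)"
  then show "\<exists>h\<in>carrier (group_algebra G). h \<oplus>\<^bsub>group_algebra G\<^esub> f = \<zero>\<^bsub>group_algebra G\<^esub>"
    by (intro bexI[of _ "\<lambda>x. - f x"]) (auto simp: group_algebra_def)
qed (auto simp: group_algebra_def algebra_simps)

lemma group_algebra_cring:
  fixes G (structure)
  assumes "comm_group G" "finite (carrier G)"
  shows "cring (group_algebra G)"
proof -
  interpret comm_group G by fact
  note [simp] = \<open>finite (carrier G)\<close>
  have comm: "f \<otimes>\<^bsub>group_algebra G\<^esub> h = h \<otimes>\<^bsub>group_algebra G\<^esub> f" for f h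
  proof -
    have "(\<Sum>y\<in>carrier G. f y * h (inv y \<otimes> x)) = (\<Sum>y\<in>carrier G. h y * f (inv y \<otimes> x))"
      if x: "x \<in> carrier G" for x
      by (rule sum.reindex_bij_witness[of _ "\<lambda>y. inv y \<otimes> x" "\<lambda>y. inv y \<otimes> x"])
         (use x in \<open>auto simp: inv_mult m_assoc\<close>)
    then show ?thesis by (auto simp: group_algebra_def fun_eq_iff)
  qed
  have assoc: "(f \<otimes>\<^bsub>group_algebra G\<^esub> h) \<otimes>\<^bsub>group_algebra G\<^esub> w
      = f \<otimes>\<^bsub>group_algebra G\<^esub> (h \<otimes>\<^bsub>group_algebra G\<^esub> w)" for f h w
  proof -
    have "(\<Sum>y\<in>carrier G. (\<Sum>z\<in>carrier G. f z * h (inv z \<otimes> y)) * w (inv y \<otimes> x))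
        = (\<Sum>z\<in>carrier G. f z * (\<Sum>y\<in>carrier G. h y * w (inv y \<otimes> (inv z \<otimes> x))))"
      if x: "x \<in> carrier G" for x
    proof -
      have "(\<Sum>y\<in>carrier G. h (inv z \<otimes> y) * w (inv y \<otimes> x))
          = (\<Sum>y\<in>carrier G. h y * w (inv y \<otimes> (inv z \<otimes> x)))" if z: "z \<in> carrier G" for z
      proof (rule sum.reindex_bij_witness[of _ "\<lambda>y. z \<otimes> y" "\<lambda>y. inv z \<otimes> y"])
        fix y assume y: "y \<in> carrier G"
        have "inv (inv z \<otimes> y) \<otimes> (inv z \<otimes> x) = inv y \<otimes> (z \<otimes> inv z) \<otimes> x"
          using x y z by (simp only: inv_mult_group inv_inv inv_closed m_closed m_assoc)
        then show "h (inv z \<otimes> y) * w (inv (inv z \<otimes> y) \<otimes> (inv z \<otimes> x))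
            = h (inv z \<otimes> y) * w (inv y \<otimes> x)"
          using x y z by simp
      qed (use z in \<open>auto simp: m_assoc[symmetric]\<close>)
      then have "(\<Sum>z\<in>carrier G. \<Sum>y\<in>carrier G. f z * (h (inv z \<otimes> y) * w (inv y \<otimes> x)))
          = (\<Sum>z\<in>carrier G. f z * (\<Sum>y\<in>carrier G. h y * w (inv y \<otimes> (inv z \<otimes> x))))"
        by (simp add: sum_distrib_left[symmetric])
      then show ?thesis
        by (subst (asm) sum.swap) (simp add: sum_distrib_right mult.assoc)
    qed
    then show ?thesis by (auto simp: group_algebra_def fun_eq_iff)
  qed
  have one: "\<one>\<^bsub>group_algebra G\<^esub> \<otimes>\<^bsub>group_algebra G\<^esub> f = f"
    if "f \<in> carrier (group_algebra G)" for f
  proof -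
    have "(\<Sum>y\<in>carrier G. (if y = \<one> then 1 else 0) * f (inv y \<otimes> x)) = f x"
      if "x \<in> carrier G" for x
    proof -
      have "(\<Sum>y\<in>carrier G. (if y = \<one> then 1 else 0) * f (inv y \<otimes> x))
          = (\<Sum>y\<in>carrier G. if y = \<one> then f (inv y \<otimes> x) else 0)"
        by (rule sum.cong) auto
      then show ?thesis using that by simp
    qed
    then show ?thesis using that by (auto simp: group_algebra_def fun_eq_iff)
  qed
  show ?thesis
  proof (rule cringI[OF group_algebra_abelian_group])
    show "comm_monoid (group_algebra G)"
      by (rule comm_monoidI; (rule assoc one comm)?) (auto simp: group_algebra_def)
  qed (auto simp: group_algebra_def fun_eq_iff sum.distrib distrib_right)
qed

lemma group_algebra_algebra:
  assumes "comm_group G" "finite (carrier G)"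
  shows "algebra complex_ring (group_algebra G)"
  by (rule algebraI[OF cring_complex_ring group_algebra_cring[OF assms]])
     (auto simp: group_algebra_def complex_ring_def fun_eq_iff algebra_simps sum_distrib_left)

end

theory Submission
  imports Defs "HOL-Library.Function_Algebras" "HOL-Library.Indicator_Function"
begin

text \<open>
  Let \<open>X\<close> be the sum of the four sets, \<open>P = X X\<^sup>-\<^sup>1\<close> and \<open>L = \<lambda>(1 - G)\<close>. The defining equations read
  \<open>D\<^sub>j X\<^sup>-\<^sup>1 + L = D\<^sub>j D\<^sub>j\<^sup>-\<^sup>1\<close>, so the elements \<open>u\<^sub>j = D\<^sub>j X\<^sup>-\<^sup>1\<close> satisfy \<open>u\<^sub>j\<^sup>2 = (u\<^sub>j + L) P\<close> and add up
  to \<open>P\<close>. At a nontrivial character with \<open>P \<noteq> 0\<close> the four numbers \<open>2 u\<^sub>j - P\<close> would equal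
  \<open>\<plusminus>s\<close> with \<open>s\<^sup>2 = P\<^sup>2 + 4\<lambda>P > P\<^sup>2\<close> and add up to \<open>-2P\<close>, which is impossible since four signs
  add up to \<open>0\<close>, \<open>\<plusminus>2\<close> or \<open>\<plusminus>4\<close>. Characters can be avoided: eliminating the \<open>u\<^sub>j\<close> gives
  \<open>3 L P\<^sup>4 + 16 L\<^sup>2 P\<^sup>3 = 0\<close> in the group algebra, and positivity of the coefficient of \<open>1\<close> in
  \<open>f f\<^sup>-\<^sup>1\<close> turns this into the vanishing of \<open>X\<close> on the augmentation ideal. Hence \<open>X = G\<close>
  and \<open>v = 4 k\<close>, so \<open>4 k - 1\<close> divides \<open>3 k\<^sup>2\<close> and therefore \<open>3\<close>.
\<close>

section \<open>Convolution algebra over the reals\<close>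

locale finite_comm_group = comm_group G for G (structure) +
  assumes finite_carrier [simp]: "finite (carrier G)"
begin

text \<open>Real coefficients suffice for indicators and make sums of squares available; the value 0
  outside the carrier turns identities in the algebra into equalities of functions.\<close>

definition conv :: "('a \<Rightarrow> real) \<Rightarrow> ('a \<Rightarrow> real) \<Rightarrow> 'a \<Rightarrow> real"  (infixl \<open>\<star>\<close> 70)
  where "f \<star> h = (\<lambda>x. if x \<in> carrier G then \<Sum>y\<in>carrier G. f y * h (inv y \<otimes> x) else 0)"

definition adj :: "('a \<Rightarrow> real) \<Rightarrow> 'a \<Rightarrow> real"
  where "adj f = (\<lambda>x. if x \<in> carrier G then f (inv x) else 0)"

lemma conv_outside: "x \<notin> carrier G \<Longrightarrow> (f \<star> h) x = 0"
  by (simp add: conv_def)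

lemma conv_commute: "f \<star> h = h \<star> f"
proof -
  have "(\<Sum>y\<in>carrier G. f y * h (inv y \<otimes> x)) = (\<Sum>y\<in>carrier G. h y * f (inv y \<otimes> x))"
    if x: "x \<in> carrier G" for x
    by (rule sum.reindex_bij_witness[of _ "\<lambda>y. inv y \<otimes> x" "\<lambda>y. inv y \<otimes> x"])
       (use x in \<open>auto simp: inv_mult m_assoc\<close>)
  then show ?thesis by (auto simp: conv_def fun_eq_iff)
qed

lemma conv_assoc: "(f \<star> h) \<star> w = f \<star> (h \<star> w)"
proof -
  have "(\<Sum>y\<in>carrier G. (\<Sum>z\<in>carrier G. f z * h (inv z \<otimes> y)) * w (inv y \<otimes> x))
      = (\<Sum>z\<in>carrier G. f z * (\<Sum>y\<in>carrier G. h y * w (inv y \<otimes> (inv z \<otimes> x))))"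
    if x: "x \<in> carrier G" for x
  proof -
    have shift: "(\<Sum>y\<in>carrier G. h (inv z \<otimes> y) * w (inv y \<otimes> x))
        = (\<Sum>y\<in>carrier G. h y * w (inv y \<otimes> (inv z \<otimes> x)))" if z: "z \<in> carrier G" for z
    proof (rule sum.reindex_bij_witness[of _ "\<lambda>y. z \<otimes> y" "\<lambda>y. inv z \<otimes> y"])
      fix y assume y: "y \<in> carrier G"
      have "inv (inv z \<otimes> y) \<otimes> (inv z \<otimes> x) = inv y \<otimes> (z \<otimes> inv z) \<otimes> x"
        using x y z by (simp only: inv_mult_group inv_inv inv_closed m_closed m_assoc)
      then show "h (inv z \<otimes> y) * w (inv (inv z \<otimes> y) \<otimes> (inv z \<otimes> x))
          = h (inv z \<otimes> y) * w (inv y \<otimes> x)"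
        using x y z by simp
    qed (use z in \<open>auto simp: m_assoc[symmetric]\<close>)
    have "(\<Sum>y\<in>carrier G. (\<Sum>z\<in>carrier G. f z * h (inv z \<otimes> y)) * w (inv y \<otimes> x))
        = (\<Sum>z\<in>carrier G. f z * (\<Sum>y\<in>carrier G. h (inv z \<otimes> y) * w (inv y \<otimes> x)))"
      unfolding sum_distrib_right sum_distrib_left
      by (subst sum.swap) (simp add: mult.assoc)
    also have "\<dots> = (\<Sum>z\<in>carrier G. f z * (\<Sum>y\<in>carrier G. h y * w (inv y \<otimes> (inv z \<otimes> x))))"
      by (intro sum.cong refl) (simp add: shift)
    finally show ?thesis .
  qed
  then show ?thesis by (auto simp: conv_def fun_eq_iff)
qed

lemma conv_left_commute: "f \<star> (h \<star> w) = h \<star> (f \<star> w)"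
  by (metis conv_assoc conv_commute)

lemma conv_scale: "(\<lambda>x. c * f x) \<star> h = (\<lambda>x. c * (f \<star> h) x)"
  by (auto simp: conv_def fun_eq_iff sum_distrib_left mult.assoc)

lemma conv_linear:
  "(f + g) \<star> h = f \<star> h + g \<star> h" "h \<star> (f + g) = h \<star> f + h \<star> g"
  "(f - g) \<star> h = f \<star> h - g \<star> h" "h \<star> (f - g) = h \<star> f - h \<star> g"
  "(- f) \<star> h = - (f \<star> h)" "h \<star> (- f) = - (h \<star> f)"
  "0 \<star> h = 0" "h \<star> 0 = 0"
  "(numeral n * f) \<star> h = numeral n * (f \<star> h)" "h \<star> (numeral n * f) = numeral n * (h \<star> f)"
proof -
  show add: "(f + g) \<star> h = f \<star> h + g \<star> h" for f g h
    by (auto simp: conv_def fun_eq_iff sum.distrib distrib_right)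
  show diff: "(f - g) \<star> h = f \<star> h - g \<star> h" for f g h
    by (auto simp: conv_def fun_eq_iff sum_subtractf left_diff_distrib)
  show neg: "(- f) \<star> h = - (f \<star> h)" for f h
    by (auto simp: conv_def fun_eq_iff sum_negf)
  show zero: "0 \<star> h = 0" for h
    by (auto simp: conv_def fun_eq_iff)
  have numeral_mult: "numeral n * f = (\<lambda>x. numeral n * f x)" for f :: "'a \<Rightarrow> real"
    by (simp add: fun_eq_iff numeral_fun)
  show num: "(numeral n * f) \<star> h = numeral n * (f \<star> h)" for f h
    by (simp only: numeral_mult conv_scale)
  show "h \<star> (f + g) = h \<star> f + h \<star> g" "h \<star> (f - g) = h \<star> f - h \<star> g" "h \<star> (- f) = - (h \<star> f)"
    "h \<star> 0 = 0" "h \<star> (numeral n * f) = numeral n * (h \<star> f)"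
    by (simp_all only: conv_commute[of h] add diff neg zero num)
qed

text \<open>Ordered rewriting to sums of sorted monomials: an identity of the commutative algebra,
  evaluated at a point, becomes linear arithmetic.\<close>

lemmas conv_normalize = conv_linear conv_assoc conv_commute conv_left_commute

section \<open>Elimination of the four roots\<close>

text \<open>
  Under any character \<open>2 u - p\<close> and \<open>2 v - p\<close> are square roots of \<open>p\<^sup>2 + 4 l p\<close>, so \<open>a\<close> is
  zero or such a root.
\<close>

lemma cube_of_root_pair:
  assumes u: "u \<star> u = (u + l) \<star> p" and v: "v \<star> v = (v + l) \<star> p"
  defines "a \<equiv> u + v - p" and "q \<equiv> p \<star> p + 4 * (l \<star> p)"
  shows "a \<star> (a \<star> a) = q \<star> a"
proof -
  define b where "b = u - v"
  \<comment> \<open>Here a b = u^2 - v^2 - p (u - v), and the hypotheses give u^2 - v^2 = (u - v)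
    p.\<close>
  have ab: "a \<star> b = 0"
  proof (rule ext)
    fix x show "(a \<star> b) x = 0 x"
      using fun_cong[OF u, of x] fun_cong[OF v, of x]
      by (simp add: a_def b_def conv_normalize)
  qed
  have q: "q = a \<star> a + b \<star> b"
  proof (rule ext)
    fix x show "q x = (a \<star> a + b \<star> b) x"
      using fun_cong[OF u, of x] fun_cong[OF v, of x]
      by (simp add: a_def b_def q_def conv_normalize)
  qed
  have "(b \<star> b) \<star> a = 0"
    by (metis ab conv_assoc conv_commute conv_linear(7))
  then show ?thesis
    by (simp add: q conv_linear conv_assoc)
qed

text \<open>Group the roots into two pairs, giving \<open>a\<close> and \<open>c\<close> with a + c
  = -p. Their cubic relations yield two equations for w = a c over p and l; eliminating w leaves the
  claim.\<close>

lemma sum_of_four_roots: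
  assumes u: "u1 \<star> u1 = (u1 + l) \<star> p" "u2 \<star> u2 = (u2 + l) \<star> p"
      "u3 \<star> u3 = (u3 + l) \<star> p" "u4 \<star> u4 = (u4 + l) \<star> p"
    and sum: "u1 + u2 + u3 + u4 = p"
  shows "3 * (l \<star> (p \<star> (p \<star> (p \<star> p)))) + 16 * (l \<star> (l \<star> (p \<star> (p \<star> p)))) = 0"
proof -
  define a where "a = u1 + u2 - p"
  define c where "c = u3 + u4 - p"
  define q where "q = p \<star> p + 4 * (l \<star> p)"
  define w where "w = a \<star> c"
  have c: "c = - p - a"
    by (simp add: a_def c_def fun_eq_iff flip: sum)
  have w: "w = - (a \<star> p) - a \<star> a"
    by (simp add: w_def c conv_linear)
  have a3: "a \<star> (a \<star> a) = q \<star> a"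
    unfolding a_def q_def by (rule cube_of_root_pair[OF u(1,2)])
  have c3: "c \<star> (c \<star> c) = q \<star> c"
    unfolding c_def q_def by (rule cube_of_root_pair[OF u(3,4)])
  \<comment> \<open>Sum of the two cubic relations, as a^3 + c^3 = -p^3 + 3 p w.\<close>
  have pw: "3 * (p \<star> w) = - (4 * (l \<star> (p \<star> p)))"
  proof (rule ext)
    fix x show "(3 * (p \<star> w)) x = (- (4 * (l \<star> (p \<star> p)))) x"
      using fun_cong[OF a3, of x] fun_cong[OF c3, of x]
      by (simp add: w c q_def conv_normalize)
  qed
  \<comment> \<open>Add c a^3 = q w and a c^3 = q w, and use a^2 + c^2 = p^2 - 2 w.\<close>
  have wp2: "w \<star> (p \<star> p) = 2 * (q \<star> w) + 2 * (w \<star> w)"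
  proof -
    have a3c: "c \<star> (a \<star> (a \<star> a)) = c \<star> (q \<star> a)" and c3a: "a \<star> (c \<star> (c \<star> c)) = a \<star> (q \<star> c)"
      by (simp_all only: a3 c3)
    have p: "p = - (a + c)"
      by (simp add: c fun_eq_iff)
    show ?thesis
    proof (rule ext)
      fix x show "(w \<star> (p \<star> p)) x = (2 * (q \<star> w) + 2 * (w \<star> w)) x"
        using fun_cong[OF a3c, of x] fun_cong[OF c3a, of x]
        unfolding w_def p by (simp add: conv_normalize)
    qed
  qed
  \<comment> \<open>One more factor p lets \<open>pw\<close> remove w from every term, twice from p
    w^2.\<close>
  have e1: "p \<star> (w \<star> (p \<star> p)) = p \<star> (2 * (q \<star> w) + 2 * (w \<star> w))"
    by (simp only: wp2)
  have e2: "f \<star> (3 * (p \<star> w)) = f \<star> (- (4 * (l \<star> (p \<star> p))))" for f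
    by (simp only: pw)
  show ?thesis
  proof (rule ext)
    fix x show "(3 * (l \<star> (p \<star> (p \<star> (p \<star> p)))) + 16 * (l \<star> (l \<star> (p \<star> (p \<star> p))))) x = 0 x"
      using fun_cong[OF e1, of x] fun_cong[OF e2[of w], of x]
        fun_cong[OF e2[of "l \<star> p"], of x] fun_cong[OF e2[of "p \<star> p"], of x]
      by (simp add: q_def conv_normalize)
  qed
qed

section \<open>Adjoint and positivity\<close>

lemma adj_add: "adj (f + h) = adj f + adj h"
  by (auto simp: adj_def fun_eq_iff)

lemma adj_adj:
  assumes "\<And>x. x \<notin> carrier G \<Longrightarrow> f x = 0"
  shows "adj (adj f) = f"
  using assms by (auto simp: adj_def fun_eq_iff)

lemma adj_conv: "adj (f \<star> h) = adj f \<star> adj h"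
proof -
  have "(\<Sum>y\<in>carrier G. f y * h (inv y \<otimes> inv x)) = (\<Sum>y\<in>carrier G. adj f y * adj h (inv y \<otimes> x))"
    if x: "x \<in> carrier G" for x
    by (rule sum.reindex_bij_witness[of _ "\<lambda>y. inv y" "\<lambda>y. inv y"])
       (use x in \<open>auto simp: adj_def inv_mult\<close>)
  then show ?thesis by (auto simp: conv_def adj_def fun_eq_iff)
qed

lemma conv_adj_at_one: "(f \<star> adj f) \<one> = (\<Sum>y\<in>carrier G. (f y)\<^sup>2)"
  by (simp add: conv_def adj_def power2_eq_square)

lemma conv_adj_at_one_nonneg: "0 \<le> (f \<star> adj f) \<one>"
  by (simp add: conv_adj_at_one sum_nonneg)

text \<open>The coefficient of 1 is the squared Euclidean norm on the carrier; this stands in for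
  Parseval's identity.\<close>

lemma conv_adj_definite:
  assumes "(f \<star> adj f) \<one> \<le> 0" and "\<And>x. x \<notin> carrier G \<Longrightarrow> f x = 0"
  shows "f = 0"
proof
  fix x
  have "(\<Sum>y\<in>carrier G. (f y)\<^sup>2) = 0"
    using assms(1) by (simp add: conv_adj_at_one sum_nonneg antisym)
  then have "\<forall>y\<in>carrier G. f y = 0"
    by (simp add: sum_nonneg_eq_0_iff)
  then show "f x = 0 x"
    using assms(2) by auto
qed

section \<open>Augmentation ideal\<close>

text \<open>The algebra element c 1 - d G; c = d = \<lambda> gives \<lambda>(1 - G).\<close>

definition unit_combination :: "real \<Rightarrow> real \<Rightarrow> 'a \<Rightarrow> real"
  where "unit_combination c d = (\<lambda>x. if x \<in> carrier G then (if x = \<one> then c else 0) - d else 0)"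

lemma unit_combination_conv:
  assumes "x \<in> carrier G"
  shows "(unit_combination c d \<star> f) x = c * f x - d * sum f (carrier G)"
proof -
  have "(\<Sum>y\<in>carrier G. unit_combination c d y * f (inv y \<otimes> x))
      = (\<Sum>y\<in>carrier G. (if y = \<one> then c * f x else 0) - d * f (inv y \<otimes> x))"
    using assms by (intro sum.cong) (auto simp: unit_combination_def algebra_simps)
  also have "\<dots> = c * f x - d * (\<Sum>y\<in>carrier G. f (inv y \<otimes> x))"
    by (simp add: sum_subtractf sum_distrib_left)
  also have "(\<Sum>y\<in>carrier G. f (inv y \<otimes> x)) = sum f (carrier G)"
    by (rule sum.reindex_bij_witness[of _ "\<lambda>y. x \<otimes> inv y" "\<lambda>y. inv y \<otimes> x"])
       (use assms in \<open>auto simp: inv_mult m_assoc m_lcomm\<close>)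
  finally show ?thesis
    using assms by (simp add: conv_def)
qed

lemma sum_unit_combination:
  "sum (unit_combination c d) (carrier G) = c - d * real (order G)"
  by (simp add: unit_combination_def sum_subtractf order_def)

text \<open>
  Multiplication by \<^term>\<open>unit_combination (order G) 1\<close> is, up to the factor \<^term>\<open>order G\<close>,
  the projection onto the augmentation ideal.
\<close>

lemma unit_combination_conv_augmentation:
  "unit_combination c d \<star> unit_combination (order G) 1
     = (\<lambda>x. c * unit_combination (order G) 1 x)"
proof
  fix x
  show "(unit_combination c d \<star> unit_combination (order G) 1) x
      = c * unit_combination (order G) 1 x"
    \<comment> \<open>The second factor has coefficient sum 0, so the G-part of the first one
      annihilates it.\<close>
    by (cases "x \<in> carrier G")
       (auto simp: unit_combination_conv sum_unit_combination conv_outside,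
        simp add: unit_combination_def)
qed

lemma adj_unit_combination: "adj (unit_combination c d) = unit_combination c d"
  by (auto simp: adj_def unit_combination_def fun_eq_iff inv_eq_1_iff)

section \<open>Constancy of the sum of four sets\<close>

text \<open>Multiplied by E^2, the eliminated relation has two nonnegative terms at 1, so they
  vanish. Definiteness then strips factors: E kills p S, p^2, p and finally S.\<close>

lemma difference_family_sum_constant:
  fixes F :: "nat \<Rightarrow> 'a \<Rightarrow> real" and S :: "'a \<Rightarrow> real" and l :: real
  assumes S: "S = F 1 + F 2 + F 3 + F 4"
    and supp: "\<And>j x. x \<notin> carrier G \<Longrightarrow> F j x = 0" and "l > 0"
    and eq: "\<And>j. j \<in> {1..4} \<Longrightarrow> F j \<star> adj S + unit_combination l l = F j \<star> adj (F j)"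
    and x: "x \<in> carrier G"
  shows "order G * S x = sum S (carrier G)"
proof -
  define E where "E = unit_combination (order G) 1"
  define L where "L = unit_combination l l"
  define p where "p = S \<star> adj S"
  have suppS: "x \<notin> carrier G \<Longrightarrow> S x = 0" for x
    by (simp add: S supp)
  \<comment> \<open>L and the right-hand side are self-adjoint.\<close>
  have eq': "adj (F j) \<star> S + L = F j \<star> adj (F j)" if "j \<in> {1..4}" for j
  proof -
    have "adj (F j \<star> adj S + L) = adj (F j \<star> adj (F j))"
      using eq[OF that] by (simp add: L_def)
    then show ?thesis
      by (simp add: adj_add adj_conv adj_adj suppS supp L_def adj_unit_combination conv_commute)
  qed
  \<comment> \<open>As u = \<open>F j \<star> adj S\<close> is self-adjoint, u^2 is u times its
    adjoint, which regroups as \<open>F j \<star> adj (F j)\<close> times p.\<close>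
  have root: "(F j \<star> adj S) \<star> (F j \<star> adj S) = (F j \<star> adj S + L) \<star> p" if "j \<in> {1..4}" for j
  proof -
    have "F j \<star> adj S = adj (F j) \<star> S"
      using eq[OF that] eq'[OF that] unfolding L_def by (metis add_right_imp_eq)
    then have "(F j \<star> adj S) \<star> (F j \<star> adj S) = (F j \<star> adj (F j)) \<star> p"
      unfolding p_def by (metis conv_assoc conv_left_commute)
    then show ?thesis
      using eq[OF that] by (simp add: L_def)
  qed
  have res: "3 * (L \<star> (p \<star> (p \<star> (p \<star> p)))) + 16 * (L \<star> (L \<star> (p \<star> (p \<star> p)))) = 0"
    by (rule sum_of_four_roots[of "F 1 \<star> adj S" L p "F 2 \<star> adj S" "F 3 \<star> adj S" "F 4 \<star> adj S"])
       ((rule root, simp)+, simp add: p_def S conv_linear)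
  have E_adj: "adj E = E"
    by (simp add: E_def adj_unit_combination)
  have p_adj: "adj p = p"
    by (simp add: p_def adj_conv adj_adj suppS conv_commute)
  have EE: "E \<star> (E \<star> f) = (\<lambda>x. order G * (E \<star> f) x)" for f
    by (simp add: E_def unit_combination_conv_augmentation conv_scale flip: conv_assoc)
  \<comment> \<open>On the augmentation ideal L acts as the positive scalar l.\<close>
  have LE: "L \<star> (E \<star> f) = (\<lambda>x. l * (E \<star> f) x)" for f
    by (simp add: E_def L_def unit_combination_conv_augmentation conv_scale flip: conv_assoc)
  have LLE: "L \<star> (L \<star> (E \<star> f)) = (\<lambda>x. l * (l * (E \<star> f) x))" for f
    by (metis LE conv_left_commute)
  have "E \<star> (p \<star> S) = 0"
  proof (rule conv_adj_definite)
    \<comment> \<open>Both powers of p become norms: p^4 from p^2, and the odd power p^3 from p S,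
      because p is S times its adjoint.\<close>
    define A where "A = E \<star> (p \<star> p)"
    define B where "B = E \<star> (p \<star> S)"
    have A: "A \<star> adj A = E \<star> (E \<star> (p \<star> (p \<star> (p \<star> p))))"
      by (simp add: A_def adj_conv E_adj p_adj conv_normalize)
    have B: "B \<star> adj B = E \<star> (E \<star> (p \<star> (p \<star> p)))"
    proof -
      have "B \<star> adj B = E \<star> (E \<star> (p \<star> (p \<star> (S \<star> adj S))))"
        by (simp add: B_def adj_conv E_adj p_adj conv_normalize)
      then show ?thesis by (simp add: p_def)
    qed
    have "E \<star> (E \<star> (3 * (L \<star> (p \<star> (p \<star> (p \<star> p)))) + 16 * (L \<star> (L \<star> (p \<star> (p \<star> p)))))) = 0"
      by (simp only: res conv_linear)
    then have "3 * (L \<star> (E \<star> (E \<star> (p \<star> (p \<star> (p \<star> p))))))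
        + 16 * (L \<star> (L \<star> (E \<star> (E \<star> (p \<star> (p \<star> p)))))) = 0"
      by (simp only: conv_linear conv_left_commute[of E L])
    then have vanishing: "3 * (l * (A \<star> adj A) \<one>) + 16 * (l * (l * (B \<star> adj B) \<one>)) = 0"
      unfolding A B LLE unfolding LE by (simp add: fun_eq_iff)
    then show "(B \<star> adj B) \<one> \<le> 0"
    proof -
      have "0 \<le> 3 * (l * (A \<star> adj A) \<one>)"
        using \<open>l > 0\<close> conv_adj_at_one_nonneg[of A] by simp
      with vanishing have "l * (l * (B \<star> adj B) \<one>) \<le> 0" by linarith
      then show ?thesis
        using \<open>l > 0\<close> by (simp add: mult_le_0_iff)
    qed
  qed (simp add: conv_outside)
  then have pp: "E \<star> (p \<star> p) = 0"
    by (metis conv_assoc conv_linear(7) p_def)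
  have Ep: "E \<star> p = 0"
  proof (rule conv_adj_definite)
    have "(E \<star> p) \<star> adj (E \<star> p) = E \<star> (E \<star> (p \<star> p))"
      by (simp add: adj_conv E_adj p_adj conv_normalize)
    then show "((E \<star> p) \<star> adj (E \<star> p)) \<one> \<le> 0"
      by (simp add: pp conv_linear)
  qed (simp add: conv_outside)
  have "E \<star> S = 0"
  proof (rule conv_adj_definite)
    have "(E \<star> S) \<star> adj (E \<star> S) = E \<star> (E \<star> p)"
      by (simp add: adj_conv E_adj p_def conv_normalize)
    then show "((E \<star> S) \<star> adj (E \<star> S)) \<one> \<le> 0"
      by (simp add: Ep conv_linear)
  qed (simp add: conv_outside)
  then show ?thesis
    using unit_combination_conv[OF x, of "order G" 1 S] by (simp add: E_def)
qed

end

section \<open>Transfer from the complex group algebra\<close>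

lemma group_algebra_finsum_apply:
  assumes "finite A" and "\<And>i. i \<in> A \<Longrightarrow> f i \<in> carrier (group_algebra G)"
  shows "(\<Oplus>\<^bsub>group_algebra G\<^esub> i\<in>A. f i) x = (\<Sum>i\<in>A. f i x)"
proof -
  interpret R: abelian_group "group_algebra G"
    by (rule group_algebra_abelian_group)
  have add: "(f \<oplus>\<^bsub>group_algebra G\<^esub> g) x = f x + g x" for f g
    by (simp add: group_algebra_def)
  have zero: "\<zero>\<^bsub>group_algebra G\<^esub> x = 0"
    by (simp add: group_algebra_def)
  show ?thesis
    using assms
  proof (induction A rule: finite_induct)
    case empty
    then show ?case by (simp add: zero)
  next
    case (insert i A)
    then have "f \<in> A \<rightarrow> carrier (group_algebra G)" "f i \<in> carrier (group_algebra G)"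
      by auto
    with insert show ?case by (simp add: add)
  qed
qed

lemma group_algebra_minus_apply:
  assumes "f \<in> carrier (group_algebra G)" "h \<in> carrier (group_algebra G)"
  shows "(f \<ominus>\<^bsub>group_algebra G\<^esub> h) x = f x - h x"
proof -
  interpret R: abelian_group "group_algebra G"
    by (rule group_algebra_abelian_group)
  have "\<ominus>\<^bsub>group_algebra G\<^esub> h = (\<lambda>x. - h x)"
    by (rule R.minus_equality) (use assms in \<open>auto simp: group_algebra_def\<close>)
  then show ?thesis
    by (simp add: a_minus_def group_algebra_def)
qed

context finite_comm_group
begin

lemma set_elem_apply:
  assumes "S \<subseteq> carrier G"
  shows "set_elem G S x = of_real (indicator S x)"
proof -
  have "finite S" using assms finite_carrier by (rule finite_subset)
  have "set_elem G S x = (\<Sum>g\<in>S. group_elem g x)"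
    unfolding set_elem_def using assms \<open>finite S\<close>
    by (intro group_algebra_finsum_apply) (auto simp: group_algebra_def group_elem_def)
  also have "\<dots> = of_real (indicator S x)"
    using \<open>finite S\<close> by (simp add: group_elem_def indicator_def)
  finally show ?thesis .
qed

lemma set_inv_elem_apply:
  assumes "S \<subseteq> carrier G"
  shows "set_inv_elem G S x = of_real (adj (indicator S) x)"
proof -
  have "finite S" using assms finite_carrier by (rule finite_subset)
  have "set_inv_elem G S x = (\<Sum>g\<in>S. group_elem (inv g) x)"
    unfolding set_inv_elem_def using assms \<open>finite S\<close>
    by (intro group_algebra_finsum_apply) (auto simp: group_algebra_def group_elem_def)
  also have "\<dots> = (\<Sum>g\<in>S. if g = inv x \<and> x \<in> carrier G then 1 else 0)"
    using assms by (intro sum.cong) (auto simp: group_elem_def)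
  also have "\<dots> = of_real (adj (indicator S) x)"
    using \<open>finite S\<close> by (auto simp: adj_def indicator_def)
  finally show ?thesis .
qed

lemma group_algebra_mult_apply:
  assumes "S \<subseteq> carrier G" "T \<subseteq> carrier G"
  shows "(set_elem G S \<otimes>\<^bsub>group_algebra G\<^esub> set_inv_elem G T) x
     = of_real ((indicator S \<star> adj (indicator T)) x)"
  using assms by (simp add: group_algebra_def conv_def set_elem_apply set_inv_elem_apply
      flip: of_real_mult of_real_sum)

text \<open>All coefficients in the defining equation are real, so it descends to real convolution;
  the sign arises from \<lambda>(G - 1) = -\<lambda>(1 - G).\<close>

lemma SEDF_indicator_equation:
  fixes F :: "nat \<Rightarrow> 'a \<Rightarrow> real"
  assumes sedf: "SEDF G D v m k l" and j: "j \<in> {1..m}"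
  defines "F i \<equiv> indicator (D i)"
  shows "(\<Sum>i\<in>{1..m} - {j}. (F j \<star> adj (F i)) x) = - unit_combination l l x"
proof -
  have D: "D i \<subseteq> carrier G" if "i \<in> {1..m}" for i
    using sedf that by (auto simp: SEDF_def)
  have closed: "set_elem G (D j) \<otimes>\<^bsub>group_algebra G\<^esub> set_inv_elem G (D i) \<in> carrier (group_algebra G)" for i
    by (simp add: group_algebra_def)
  have "complex_of_real (\<Sum>i\<in>{1..m} - {j}. (F j \<star> adj (F i)) x)
      = (\<Oplus>\<^bsub>group_algebra G\<^esub> i\<in>{1..m} - {j}.
            set_elem G (D j) \<otimes>\<^bsub>group_algebra G\<^esub> set_inv_elem G (D i)) x"
    using j by (simp add: group_algebra_finsum_apply closed group_algebra_mult_apply D F_def)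
  also have "\<dots> = (of_nat l \<odot>\<^bsub>group_algebra G\<^esub>
            (set_elem G (carrier G) \<ominus>\<^bsub>group_algebra G\<^esub> \<one>\<^bsub>group_algebra G\<^esub>)) x"
    using sedf j by (simp add: SEDF_def)
  also have "\<dots> = of_nat l * (set_elem G (carrier G) x - \<one>\<^bsub>group_algebra G\<^esub> x)"
  proof -
    have "set_elem G (carrier G) \<in> carrier (group_algebra G)"
      "\<one>\<^bsub>group_algebra G\<^esub> \<in> carrier (group_algebra G)"
      using set_elem_apply[of "carrier G"] by (auto simp: group_algebra_def)
    from group_algebra_minus_apply[OF this] show ?thesis
      by (simp add: group_algebra_def)
  qed
  also have "\<dots> = complex_of_real (- unit_combination l l x)"
    by (auto simp: set_elem_apply unit_combination_def group_algebra_def)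
  finally show ?thesis
    by (simp only: of_real_eq_iff)
qed

section \<open>Order of the group and divisibility\<close>

text \<open>The indicator of the union is constant and equals 1 on \<open>D 1\<close>, so the four
  disjoint k-sets fill the group.\<close>

lemma SEDF_four_order:
  assumes sedf: "SEDF G D v 4 k l"
  shows "v = 4 * k"
proof -
  \<comment> \<open>\<open>D i\<close> is unconstrained for other indices; the empty set there gives
    every \<open>F i\<close> support in the carrier.\<close>
  define F :: "nat \<Rightarrow> 'a \<Rightarrow> real" where "F i = indicator (if i \<in> {1..4} then D i else {})" for i
  define S where "S = F 1 + F 2 + F 3 + F 4"
  have D: "D i \<subseteq> carrier G" "card (D i) = k" if "i \<in> {1..4}" for i
    using sedf that by (auto simp: SEDF_def)
  have "k > 0" "l > 0" and v: "order G = v" and disj: "disjoint_family_on D {1..4}"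
    using sedf by (auto simp: SEDF_def)
  have F: "F i = indicator (D i)" if "i \<in> {1..4}" for i
    using that by (auto simp: F_def)
  have S': "S x = (\<Sum>i\<in>{1..4}. F i x)" for x
    by (simp add: S_def numeral_eq_Suc)
  have adjS: "adj S x = (\<Sum>i\<in>{1..4}. adj (F i) x)" for x
    by (simp add: adj_def S')
  have "D 1 \<noteq> {}"
    using D(2)[of 1] \<open>k > 0\<close> by auto
  then obtain x where x: "x \<in> D 1" by blast
  then have xG: "x \<in> carrier G" using D(1)[of 1] by auto
  have "order G * S x = sum S (carrier G)"
  proof (rule difference_family_sum_constant[of S F "real l"])
    fix j :: nat assume j: "j \<in> {1..4}"
    show "F j \<star> adj S + unit_combination l l = F j \<star> adj (F j)"
    proof
      fix y
      have "(F j \<star> adj S) y = (\<Sum>i\<in>{1..4}. (F j \<star> adj (F i)) y)"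
        by (simp add: S_def adj_add conv_linear numeral_eq_Suc)
      also have "\<dots> = (F j \<star> adj (F j)) y + (\<Sum>i\<in>{1..4} - {j}. (F j \<star> adj (F i)) y)"
        using j by (simp add: sum.remove)
      also have "(\<Sum>i\<in>{1..4} - {j}. (F j \<star> adj (F i)) y) = - unit_combination l l y"
        using SEDF_indicator_equation[OF sedf j, of y] j by (simp add: F)
      finally show "(F j \<star> adj S + unit_combination l l) y = (F j \<star> adj (F j)) y"
        by simp
    qed
  qed (use D(1) \<open>l > 0\<close> xG in \<open>auto simp: S_def F_def indicator_def\<close>)
  moreover have "S x = 1"
  proof -
    have "x \<notin> D i" if "i \<in> {1..4} - {1}" for i
      using disjoint_family_onD[OF disj, of 1 i] that x by auto
    then have "(\<Sum>i\<in>{1..4}. F i x) = (\<Sum>i\<in>{1..4::nat}. if i = 1 then 1 else 0)"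
      using x by (intro sum.cong) (auto simp: F indicator_def)
    then show ?thesis by (simp add: S')
  qed
  moreover have "sum S (carrier G) = 4 * k"
  proof -
    have "sum (F i) (carrier G) = k" if "i \<in> {1..4}" for i
      using D[OF that] that by (simp add: F indicator_def sum.If_cases Int_absorb1)
    moreover have "sum S (carrier G) = (\<Sum>i\<in>{1..4}. sum (F i) (carrier G))"
      by (subst sum.swap) (simp add: S')
    ultimately show ?thesis by simp
  qed
  ultimately show ?thesis
    using v by (simp flip: of_nat_mult)
qed

end

theorem theorem3p6:
  fixes v k l :: nat
  assumes "v > 4"
  shows "\<not> (\<exists>(G :: ('a, 'b) monoid_scheme) D. SEDF G D v 4 k l)"
proof
  assume "\<exists>(G :: ('a, 'b) monoid_scheme) D. SEDF G D v 4 k l"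
  then obtain G :: "('a, 'b) monoid_scheme" and D where sedf: "SEDF G D v 4 k l"
    by blast
  interpret comm_group G
    using sedf by (simp add: SEDF_def)
  interpret finite_comm_group G
    by unfold_locales (use sedf in \<open>simp add: SEDF_def\<close>)
  have v: "v = 4 * k"
    by (rule SEDF_four_order[OF sedf])
  have "k\<^sup>2 * 3 = l * (v - 1)"
    using sedf by (simp add: SEDF_def)
  then have "int (k\<^sup>2 * 3) = int (l * (4 * k - 1))"
    using v by simp
  then have eq: "3 * (int k)\<^sup>2 = int l * (4 * int k - 1)"
    using assms v by (simp add: of_nat_diff)
  \<comment> \<open>Multiply \<open>eq\<close> by 16 and write 16 k^2 = (4 k - 1)(4 k + 1) +
    1.\<close>
  have "3 = (4 * int k - 1) * (16 * int l - 12 * int k - 3)"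
    using eq by (simp add: algebra_simps power2_eq_square)
  then have "4 * int k - 1 dvd 3"
    by (metis dvd_triv_left)
  then have "4 * int k - 1 \<le> 3"
    by (rule zdvd_imp_le) simp
  then show False
    using assms v by simp
qed

end
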